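(* Let $d\ge 1$ be an integer, let $\mathcal{H}_A\cong\mathbb{C}^d$, and let $\mathbb{NPTBC}$ denote the set of NPT-breaking channels on $\mathcal{L}(\mathcal{H}_A)$. For every quantum channel $\mathcal{R}:\mathcal{L}(\mathcal{H}_A)\to\mathcal{L}(\mathcal{H}_A)$ with $\mathcal{R}\notin\mathbb{NPTBC}$, there exists a semiquantum signaling game for which the average payoff satisfies $\tilde{\mathscr{J}}_{\mathrm{avg}}(\mathcal{R})<0$, while $\tilde{\mathscr{J}}_{\mathrm{avg}}(\mathcal{S})\ge 0$ for all $\mathcal{S}\in\mathbb{NPTBC}$. That is, there is a game such that: (i) there exists a measurement $M$ of Bob with $\tilde{\mathscr{J}}_{\mathrm{avg}}(\mathcal{R};M)<0$; and (ii) for every $\mathcal{S}\in\mathbb{NPTBC}$ and every measurement $M$ of Bob, $\tilde{\mathscr{J}}_{\mathrm{avg}}(\mathcal{S};M)\ge 0$.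
   Context: All Hilbert spaces are finite-dimensional complex; $\mathcal{L}(\mathcal{H})$ is the space of linear operators on $\mathcal{H}$ and $\mathcal{D}(\mathcal{H})$ the set of density operators (positive semidefinite, trace one). A quantum channel on $\mathcal{L}(\mathcal{H})$ is a linear, completely positive, trace-preserving map $\mathcal{L}(\mathcal{H})\to\mathcal{L}(\mathcal{H})$. NPT-breaking channels. A bipartite state $\rho_{AB}$ is PPT (positive under partial transpose) if its partial transpose on the second factor (in the computational basis) satisfies $\rho_{AB}^{\intercal_B}\ge 0$, and NPT otherwise. A channel $\mathcal{S}$ on $\mathcal{L}(\mathbb{C}^{d})$ is NPT-breaking if $(\mathbf{id}\otimes\mathcal{S})(\rho)$ is PPT for all $\rho\in\mathcal{D}(\mathbb{C}^{m}\otimes\mathbb{C}^{d})$ and all $m\ge 1$, where $\mathbf{id}$ is the identity channel on $\mathcal{L}(\mathbb{C}^{m})$. Semiquantum signaling game. A game consists of: a finite family of states $\{\psi_A^x\}_x\subset\mathcal{D}(\mathcal{H}_A)$ and a finite family of states $\{\phi_B^y\}_y\subset\mathcal{D}(\mathcal{H}_B)$ for some finite-dimensional Hilbert space $\mathcal{H}_B$ (each family consisting of states that are not all mutually orthogonal); probability distributions $p(\psi_A^x)$ over $x$ and $p(\phi_B^y)$ over $y$; a finite set of outcomes $b$; and a real-valued payoff function $\tilde{\mathscr{J}}(b,x,y)$. The referee sends $\psi_A^x$ to Alice, who applies a channel $\mathcal{R}$ on $\mathcal{L}(\mathcal{H}_A)$; Bob receives the output $\mathcal{R}(\psi_A^x)$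 together with $\phi_B^y$ from the referee, and performs a joint measurement (POVM) $M=\{\Pi^b_{AB}\}_b$ on $\mathcal{H}_A\otimes\mathcal{H}_B$ (i.e. $\Pi^b_{AB}\ge 0$, $\sum_b\Pi^b_{AB}=\mathbb{I}_{AB}$), reporting the outcome $b$. The resulting correlation is $$p(b|\psi_A^x,\phi_B^y)=\mathrm{Tr}\left[\left(\mathcal{R}(\psi_A^x)\otimes\phi_B^y\right)\Pi^b_{AB}\right],$$ and the average payoff is $$\tilde{\mathscr{J}}_{\mathrm{avg}}(\mathcal{R};M)=\sum_{b,x,y}\tilde{\mathscr{J}}(b,x,y)\,p(b|\psi_A^x,\phi_B^y)\,p(\psi_A^x)\,p(\phi_B^y).$$ *)

theory Defs
  imports "Jordan_Normal_Form.Matrix"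
begin

text \<open>
  Operators on the Hilbert space of dimension \<open>n\<close> are elements of \<^term>\<open>carrier_mat n n :: complex mat set\<close>,
  i.e. matrices in the computational basis. The basis vector \<open>e\<^sub>i \<otimes> e\<^sub>j\<close> of the tensor product of
  spaces of dimensions \<open>m\<close> and \<open>d\<close> has index \<open>i * d + j\<close>.
  Maps on operators are total functions on \<^typ>\<open>complex mat\<close>, of which only the restriction to
  \<^term>\<open>carrier_mat d d\<close> matters.
\<close>

definition mat_trace :: "complex mat \<Rightarrow> complex" where
  "mat_trace A = (\<Sum>i<dim_row A. A $$ (i, i))"

text \<open>
  The order on \<^typ>\<open>complex\<close> is that of \<^theory>\<open>HOL-Library.Complex_Order\<close>: \<open>0 \<le> z\<close> says that \<open>z\<close> is real
  and nonnegative. Hence Hermiticity is implied here.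
\<close>

definition psd :: "nat \<Rightarrow> complex mat \<Rightarrow> bool" where
  "psd n A \<longleftrightarrow> A \<in> carrier_mat n n \<and> (\<forall>v \<in> carrier_vec n. 0 \<le> (A *\<^sub>v v) \<bullet>c v)"

definition density_operator :: "nat \<Rightarrow> complex mat \<Rightarrow> bool" where
  "density_operator n \<rho> \<longleftrightarrow> psd n \<rho> \<and> mat_trace \<rho> = 1"

definition kron :: "complex mat \<Rightarrow> complex mat \<Rightarrow> complex mat" where
  "kron A B = mat (dim_row A * dim_row B) (dim_col A * dim_col B)
     (\<lambda>(i, j). A $$ (i div dim_row B, j div dim_col B) * B $$ (i mod dim_row B, j mod dim_col B))"

definition block :: "nat \<Rightarrow> complex mat \<Rightarrow> nat \<Rightarrow> nat \<Rightarrow> complex mat" where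
  "block d X a b = mat d d (\<lambda>(k, l). X $$ (a * d + k, b * d + l))"

text \<open>
  The map \<open>id \<otimes> R\<close>, where \<open>id\<close> acts on \<open>m \<times> m\<close> matrices and \<open>R\<close> on \<open>d \<times> d\<close> matrices: since
  \<open>X = (\<Sum>a b. E\<^sub>a\<^sub>b \<otimes> X\<^sub>a\<^sub>b)\<close> with \<open>X\<^sub>a\<^sub>b\<close> the blocks of \<open>X\<close>, linearity forces it to act by \<open>R\<close> on each
  \<open>d \<times> d\<close> block. See \<open>id_tensor_kron\<close> below.
\<close>

definition id_tensor :: "nat \<Rightarrow> nat \<Rightarrow> (complex mat \<Rightarrow> complex mat) \<Rightarrow> complex mat \<Rightarrow> complex mat" where
  "id_tensor m d R X = mat (m * d) (m * d)
     (\<lambda>(i, j). R (block d X (i div d) (j div d)) $$ (i mod d, j mod d))"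

definition partial_transpose :: "nat \<Rightarrow> nat \<Rightarrow> complex mat \<Rightarrow> complex mat" where
  "partial_transpose m d X = mat (m * d) (m * d)
     (\<lambda>(i, j). X $$ ((i div d) * d + j mod d, (j div d) * d + i mod d))"

definition linear_map :: "nat \<Rightarrow> (complex mat \<Rightarrow> complex mat) \<Rightarrow> bool" where
  "linear_map d R \<longleftrightarrow>
     (\<forall>A \<in> carrier_mat d d. R A \<in> carrier_mat d d) \<and>
     (\<forall>A \<in> carrier_mat d d. \<forall>B \<in> carrier_mat d d. R (A + B) = R A + R B) \<and>
     (\<forall>A \<in> carrier_mat d d. \<forall>c. R (c \<cdot>\<^sub>m A) = c \<cdot>\<^sub>m R A)"

definition completely_positive :: "nat \<Rightarrow> (complex mat \<Rightarrow> complex mat) \<Rightarrow> bool" where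
  "completely_positive d R \<longleftrightarrow> (\<forall>m\<ge>1. \<forall>X. psd (m * d) X \<longrightarrow> psd (m * d) (id_tensor m d R X))"

definition trace_preserving :: "nat \<Rightarrow> (complex mat \<Rightarrow> complex mat) \<Rightarrow> bool" where
  "trace_preserving d R \<longleftrightarrow> (\<forall>A \<in> carrier_mat d d. mat_trace (R A) = mat_trace A)"

definition quantum_channel :: "nat \<Rightarrow> (complex mat \<Rightarrow> complex mat) \<Rightarrow> bool" where
  "quantum_channel d R \<longleftrightarrow> linear_map d R \<and> completely_positive d R \<and> trace_preserving d R"

definition PPT :: "nat \<Rightarrow> nat \<Rightarrow> complex mat \<Rightarrow> bool" where
  "PPT m d \<rho> \<longleftrightarrow> psd (m * d) (partial_transpose m d \<rho>)"

definition NPTBC :: "nat \<Rightarrow> (complex mat \<Rightarrow> complex mat) set" where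
  "NPTBC d = {S. quantum_channel d S \<and>
     (\<forall>m\<ge>1. \<forall>\<rho>. density_operator (m * d) \<rho> \<longrightarrow> PPT m d (id_tensor m d S \<rho>))}"

text \<open>
  The questions \<open>x\<close>, the questions \<open>y\<close> and the outcomes \<open>b\<close> are numbered \<open>0, 1, \<dots>\<close> up to
  \<open>num_x\<close>, \<open>num_y\<close> and \<open>num_b\<close> (exclusive).
\<close>

record signaling_game =
  dim_B :: nat
  num_x :: nat
  num_y :: nat
  num_b :: nat
  state_A :: "nat \<Rightarrow> complex mat"
  state_B :: "nat \<Rightarrow> complex mat"
  prob_A :: "nat \<Rightarrow> real"
  prob_B :: "nat \<Rightarrow> real"
  payoff :: "nat \<Rightarrow> nat \<Rightarrow> nat \<Rightarrow> real"

text \<open>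
  Density operators \<open>\<rho>\<close> and \<open>\<sigma>\<close> are orthogonal iff \<open>Tr (\<rho> \<sigma>) = 0\<close>. The two nonorthogonal
  members are required to be distinct, as a state is never orthogonal to itself.
\<close>

definition not_all_orthogonal :: "complex mat set \<Rightarrow> bool" where
  "not_all_orthogonal F \<longleftrightarrow> (\<exists>\<rho> \<in> F. \<exists>\<sigma> \<in> F. \<rho> \<noteq> \<sigma> \<and> mat_trace (\<rho> * \<sigma>) \<noteq> 0)"

definition probability_distribution :: "nat \<Rightarrow> (nat \<Rightarrow> real) \<Rightarrow> bool" where
  "probability_distribution n p \<longleftrightarrow> (\<forall>i<n. 0 \<le> p i) \<and> (\<Sum>i<n. p i) = 1"

definition semiquantum_signaling_game :: "nat \<Rightarrow> signaling_game \<Rightarrow> bool" where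
  "semiquantum_signaling_game d G \<longleftrightarrow>
     (\<forall>x<num_x G. density_operator d (state_A G x)) \<and>
     (\<forall>y<num_y G. density_operator (dim_B G) (state_B G y)) \<and>
     not_all_orthogonal (state_A G ` {..<num_x G}) \<and>
     not_all_orthogonal (state_B G ` {..<num_y G}) \<and>
     probability_distribution (num_x G) (prob_A G) \<and>
     probability_distribution (num_y G) (prob_B G)"

definition povm :: "nat \<Rightarrow> nat \<Rightarrow> (nat \<Rightarrow> complex mat) \<Rightarrow> bool" where
  "povm n k M \<longleftrightarrow> (\<forall>b<k. psd n (M b)) \<and> mat n n (\<lambda>ij. \<Sum>b<k. M b $$ ij) = 1\<^sub>m n"

definition bob_measurement :: "nat \<Rightarrow> signaling_game \<Rightarrow> (nat \<Rightarrow> complex mat) \<Rightarrow> bool" where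
  "bob_measurement d G M \<longleftrightarrow> povm (d * dim_B G) (num_b G) M"

text \<open>
  The trace is real when \<open>R\<close> is a channel and \<open>M\<close> a measurement; \<^const>\<open>Re\<close> is only a type conversion.
\<close>

definition correlation ::
  "signaling_game \<Rightarrow> (complex mat \<Rightarrow> complex mat) \<Rightarrow> (nat \<Rightarrow> complex mat) \<Rightarrow> nat \<Rightarrow> nat \<Rightarrow> nat \<Rightarrow> real" where
  "correlation G R M b x y = Re (mat_trace (kron (R (state_A G x)) (state_B G y) * M b))"

definition average_payoff ::
  "signaling_game \<Rightarrow> (complex mat \<Rightarrow> complex mat) \<Rightarrow> (nat \<Rightarrow> complex mat) \<Rightarrow> real" where
  "average_payoff G R M = (\<Sum>b<num_b G. \<Sum>x<num_x G. \<Sum>y<num_y G.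
     payoff G b x y * correlation G R M b x y * prob_A G x * prob_B G y)"

lemma id_tensor_kron:
  assumes R: "linear_map d R" and A: "A \<in> carrier_mat m m" and B: "B \<in> carrier_mat d d"
  shows "id_tensor m d R (kron A B) = kron A (R B)"
proof (rule eq_matI)
  have RB: "R B \<in> carrier_mat d d" using R B by (simp add: linear_map_def)
  show "dim_row (id_tensor m d R (kron A B)) = dim_row (kron A (R B))"
    and "dim_col (id_tensor m d R (kron A B)) = dim_col (kron A (R B))"
    using A RB by (simp_all add: id_tensor_def kron_def)
  fix i j assume "i < dim_row (kron A (R B))" "j < dim_col (kron A (R B))"
  hence ij: "i < m * d" "j < m * d" using A RB by (simp_all add: kron_def)
  have bound: "a * d + k < m * d" if "a < m" "k < d" for a k
  proof -
    have "a * d + k < (a + 1) * d" using that by simp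
    also have "\<dots> \<le> m * d" using that by (intro mult_right_mono) auto
    finally show ?thesis .
  qed
  have d: "d > 0" using ij by (cases d) auto
  have q: "i div d < m" "j div d < m" using ij by (simp_all add: less_mult_imp_div_less)
  have "block d (kron A B) (i div d) (j div d) = A $$ (i div d, j div d) \<cdot>\<^sub>m B"
    using A B q bound by (intro eq_matI) (auto simp: block_def kron_def)
  hence "R (block d (kron A B) (i div d) (j div d)) = A $$ (i div d, j div d) \<cdot>\<^sub>m R B"
    using R B by (simp add: linear_map_def)
  moreover have "dim_row (R B) = d" "dim_col (R B) = d" using RB by auto
  ultimately show "id_tensor m d R (kron A B) $$ (i, j) = kron A (R B) $$ (i, j)"
    using A ij d by (simp add: id_tensor_def kron_def[of A "R B"])
qed

end

theory Submission
  imports Defs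
begin

text \<open>
  Let \<open>\<rho>\<close> be a state on the ancilla and Alice's system such that \<open>(id \<otimes> R) (\<rho>)\<close> is NPT, let Bob's
  quantum question live on the ancilla, and let \<open>X\<close> be the partial transpose of \<open>\<rho>\<close> on the ancilla.
  Since \<open>X\<close> is Hermitian, it is a real combination \<open>(\<Sum>x y. \<gamma> x y (\<psi>\<^sub>x \<otimes> \<phi>\<^sub>y))\<close> of product states. With
  payoff proportional to \<open>\<gamma> x y\<close> for one outcome and zero for the other, the average payoff of a
  channel \<open>S\<close> is the trace of \<open>(S \<otimes> id) (X)\<close> times the POVM element of the first outcome. But
  \<open>(S \<otimes> id) (X)\<close> is the partial transpose of the output of \<open>S\<close> on \<open>\<rho>\<close>: it is positive for
  NPT-breaking \<open>S\<close>, whereas for \<open>R\<close> Bob can project onto a vector where it is negative.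
\<close>

section \<open>Hermitian forms\<close>

text \<open>The inner product of \<open>a v\<close> with \<open>v\<close>, kept on plain functions
  so that reindexing and Schur complements need no carrier conditions.\<close>

definition hform :: "nat \<Rightarrow> (nat \<Rightarrow> nat \<Rightarrow> complex) \<Rightarrow> (nat \<Rightarrow> complex) \<Rightarrow> complex" where
  "hform n a v = (\<Sum>i<n. \<Sum>j<n. a i j * v j * cnj (v i))"

definition psd_form :: "nat \<Rightarrow> (nat \<Rightarrow> nat \<Rightarrow> complex) \<Rightarrow> bool" where
  "psd_form n a \<longleftrightarrow> (\<forall>v. 0 \<le> hform n a v)"

lemma hform_cong:
  "(\<And>i j. i < n \<Longrightarrow> j < n \<Longrightarrow> a i j = b i j) \<Longrightarrow> (\<And>i. i < n \<Longrightarrow> v i = w i) \<Longrightarrow> hform n a v = hform n b w"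
  by (simp add: hform_def)

lemma psd_form_cong:
  "(\<And>i j. i < n \<Longrightarrow> j < n \<Longrightarrow> a i j = b i j) \<Longrightarrow> psd_form n a \<longleftrightarrow> psd_form n b"
  unfolding psd_form_def by (metis hform_cong)

lemma mult_vec_cscalar_eq_hform:
  assumes "A \<in> carrier_mat n n" "v \<in> carrier_vec n"
  shows "(A *\<^sub>v v) \<bullet>c v = hform n (\<lambda>i j. A $$ (i, j)) (\<lambda>i. v $ i)"
  using assms by (simp add: hform_def scalar_prod_def atLeast0LessThan sum_distrib_right)

lemma psd_iff_psd_form:
  "psd n A \<longleftrightarrow> A \<in> carrier_mat n n \<and> psd_form n (\<lambda>i j. A $$ (i, j))"
proof -
  have "psd_form n (\<lambda>i j. A $$ (i, j)) \<longleftrightarrow> (\<forall>v \<in> carrier_vec n. 0 \<le> (A *\<^sub>v v) \<bullet>c v)"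
    if A: "A \<in> carrier_mat n n"
  proof
    show "\<forall>v \<in> carrier_vec n. 0 \<le> (A *\<^sub>v v) \<bullet>c v" if "psd_form n (\<lambda>i j. A $$ (i, j))"
      using that A by (simp add: psd_form_def mult_vec_cscalar_eq_hform)
  next
    assume *: "\<forall>v \<in> carrier_vec n. 0 \<le> (A *\<^sub>v v) \<bullet>c v"
    show "psd_form n (\<lambda>i j. A $$ (i, j))"
      unfolding psd_form_def
    proof
      fix v
      have "0 \<le> (A *\<^sub>v vec n v) \<bullet>c vec n v" using * by simp
      also have "\<dots> = hform n (\<lambda>i j. A $$ (i, j)) v"
        using A by (simp add: mult_vec_cscalar_eq_hform del: carrier_matD cong: hform_cong)
      finally show "0 \<le> hform n (\<lambda>i j. A $$ (i, j)) v" .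
    qed
  qed
  thus ?thesis by (auto simp: psd_def)
qed

text \<open>Hermiticity, vanishing rows and Schur complements of positive forms all follow from this
  expansion by a suitable choice of \<open>t\<close>.\<close>

lemma hform_add_basis:
  assumes "k < n"
  shows "hform n a (\<lambda>i. v i + (if i = k then t else 0)) =
    hform n a v + t * (\<Sum>i<n. a i k * cnj (v i)) + cnj t * (\<Sum>j<n. a k j * v j) + t * cnj t * a k k"
proof -
  have "hform n a (\<lambda>i. v i + (if i = k then t else 0)) =
    (\<Sum>i<n. \<Sum>j<n. a i j * v j * cnj (v i)) +
    (\<Sum>i<n. \<Sum>j<n. if j = k then a i j * t * cnj (v i) else 0) +
    (\<Sum>i<n. \<Sum>j<n. if i = k then a i j * v j * cnj t else 0) +
    (\<Sum>i<n. \<Sum>j<n. if i = k then if j = k then a i j * t * cnj t else 0 else 0)"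
    unfolding hform_def sum.distrib[symmetric] by (intro sum.cong refl) (simp add: algebra_simps)
  \<comment> \<open>A condition on the outer index has to leave the inner sum before the outer sum
    can collapse.\<close>
  also have "(\<Sum>i<n. \<Sum>j<n. if i = k then a i j * v j * cnj t else 0) =
      (\<Sum>i<n. if i = k then \<Sum>j<n. a i j * v j * cnj t else 0)"
    by (intro sum.cong) auto
  also have "(\<Sum>i<n. \<Sum>j<n. if i = k then if j = k then a i j * t * cnj t else 0 else 0) =
      (\<Sum>i<n. if i = k then \<Sum>j<n. if j = k then a i j * t * cnj t else 0 else 0)"
    by (intro sum.cong) auto
  finally show ?thesis
    using assms by (simp add: hform_def sum_distrib_left mult_ac)
qed

lemma hform_basis:
  assumes "k < n"
  shows "hform n a (\<lambda>i. if i = k then t else 0) = t * cnj t * a k k"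
  using hform_add_basis[OF assms, of a "\<lambda>_. 0" t] by (simp add: hform_def)

lemma complex_divide_nonneg:
  fixes x y :: complex
  assumes "0 \<le> x" "0 \<le> y"
  shows "0 \<le> x / y"
  using assms by (simp add: less_eq_complex_def Re_divide Im_divide)

section \<open>Entries and Schur complements of positive forms\<close>

lemma psd_form_diag_nonneg:
  assumes "psd_form n a" "k < n"
  shows "0 \<le> a k k"
  using assms hform_basis[of k n a 1] by (metis psd_form_def complex_cnj_one mult_1)

lemma psd_form_hermitian:
  assumes a: "psd_form n a" and "i < n" "j < n"
  shows "cnj (a i j) = a j i"
proof (cases "i = j")
  case True
  thus ?thesis using psd_form_diag_nonneg[OF a \<open>i < n\<close>] by (simp add: less_eq_complex_def complex_eq_iff)
next
  case False
  have "0 \<le> a i i + t * a i j + cnj t * a j i + t * cnj t * a j j" for t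
  proof -
    have "0 \<le> hform n a (\<lambda>k. (if k = i then 1 else 0) + (if k = j then t else 0))"
      using a by (simp add: psd_form_def)
    also have "\<dots> = a i i + t * a i j + cnj t * a j i + t * cnj t * a j j"
      using \<open>i < n\<close> \<open>j < n\<close>
      by (simp add: hform_add_basis hform_basis if_distrib[where f = cnj] if_distrib[where f = "(*) _"] cong: if_cong)
    finally show ?thesis .
  qed
  \<comment> \<open>Realness at \<open>t = 1\<close> makes the imaginary parts opposite, and
    realness at \<open>t = \<i>\<close> makes the real parts equal.\<close>
  from this[of 1] this[of \<i>] show ?thesis
    using psd_form_diag_nonneg[OF a \<open>i < n\<close>] psd_form_diag_nonneg[OF a \<open>j < n\<close>]
    by (simp add: less_eq_complex_def complex_eq_iff)
qed

lemma hform_hermitian_real: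
  assumes "\<And>i j. i < n \<Longrightarrow> j < n \<Longrightarrow> cnj (a i j) = a j i"
  shows "Im (hform n a v) = 0"
proof -
  have "cnj (hform n a v) = (\<Sum>i<n. \<Sum>j<n. a j i * v i * cnj (v j))"
    using assms by (simp add: hform_def mult_ac)
  also have "\<dots> = hform n a v" unfolding hform_def by (rule sum.swap)
  finally show ?thesis by (simp add: complex_eq_iff)
qed

lemma psd_form_add_basis:
  assumes a: "psd_form n a" and k: "k < n"
  defines "g \<equiv> \<lambda>v. \<Sum>j<n. a k j * v j"
  shows "0 \<le> hform n a v + t * cnj (g v) + cnj t * g v + t * cnj t * a k k"
proof -
  have "(\<Sum>i<n. a i k * cnj (v i)) = cnj (g v)"
    using psd_form_hermitian[OF a k] by (simp add: g_def)
  thus ?thesis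
    using a hform_add_basis[OF k, of a v t] by (metis psd_form_def g_def)
qed

text \<open>Without the quadratic term the form at \<open>e_j + t e_k\<close> is real-affine in
  \<open>t\<close>, so a nonzero slope would make it negative somewhere.\<close>

lemma psd_form_zero_diag:
  assumes a: "psd_form n a" and k: "k < n" and j: "j < n" and 0: "a k k = 0"
  shows "a k j = 0"
proof (rule ccontr)
  let ?g = "a k j" let ?h = "Re (a j j)"
  assume nz: "?g \<noteq> 0"
  have g: "(\<Sum>i<n. a k i * (if i = j then 1 else 0)) = ?g"
    using j by (simp add: if_distrib cong: if_cong)
  \<comment> \<open>With this \<open>t\<close> each of the two linear terms is
    \<open>- (?h + 1)\<close>, which leaves the value \<open>- ?h - 2\<close>.\<close>
  define t where "t = - of_real (?h + 1) / cnj ?g"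
  have t: "t * cnj ?g = - of_real (?h + 1)" "cnj t * ?g = - of_real (?h + 1)"
    using nz by (simp_all add: t_def)
  have "0 \<le> hform n a (\<lambda>i. if i = j then 1 else 0) + t * cnj ?g + cnj t * ?g"
    using psd_form_add_basis[OF a k, of "\<lambda>i. if i = j then 1 else 0" t] unfolding g
    by (simp add: 0)
  hence "0 \<le> ?h - 2 * (?h + 1)"
    unfolding t by (simp add: hform_basis[OF j] less_eq_complex_def)
  thus False using psd_form_diag_nonneg[OF a j] by (simp add: less_eq_complex_def)
qed

text \<open>The minimum over \<open>t\<close> of the form \<open>a\<close> at
  \<open>v + t e_k\<close> is the form of the Schur complement at \<open>v\<close>.\<close>

lemma psd_form_schur_complement:
  assumes a: "psd_form n a" and k: "k < n" and nz: "a k k \<noteq> 0"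
  shows "psd_form n (\<lambda>i j. a i j - a i k * a k j / a k k)"
  unfolding psd_form_def
proof
  fix v
  define g where "g = (\<Sum>j<n. a k j * v j)"
  \<comment> \<open>The minimizer: it makes entry \<open>k\<close> of \<open>a (v + t e_k)\<close>
    vanish.\<close>
  define t where "t = - g / a k k"
  have real: "cnj (a k k) = a k k" using psd_form_hermitian[OF a k k] .
  have "(\<Sum>i<n. a i k * cnj (v i)) = cnj g"
    using psd_form_hermitian[OF a k] by (simp add: g_def)
  moreover have "(\<Sum>i<n. \<Sum>j<n. a i k * a k j * v j * cnj (v i)) = (\<Sum>i<n. a i k * cnj (v i)) * g"
    unfolding g_def sum_product by (intro sum.cong refl) simp
  ultimately have "(\<Sum>i<n. \<Sum>j<n. a i k * a k j * v j * cnj (v i)) = cnj g * g" by simp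
  hence "hform n (\<lambda>i j. a i j - a i k * a k j / a k k) v = hform n a v - cnj g * g / a k k"
    by (simp add: hform_def algebra_simps sum_subtractf flip: sum_divide_distrib)
  also have "\<dots> = hform n a v + t * cnj g + cnj t * g + t * cnj t * a k k"
    using nz by (simp add: t_def real field_simps)
  also have "0 \<le> \<dots>" using psd_form_add_basis[OF a k] by (simp add: g_def)
  finally show "0 \<le> hform n (\<lambda>i j. a i j - a i k * a k j / a k k) v" .
qed

text \<open>Peeling off the rank-one matrices of Schur complements replaces the spectral theorem.\<close>

lemma psd_form_trace_mult_nonneg:
  assumes "psd_form n a" "psd_form n b"
  shows "0 \<le> (\<Sum>i<n. \<Sum>j<n. a i j * b j i)"
  using assms(1)
\<comment> \<open>The measure drops because a Schur complement clears one nonzero diagonal entry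
  and, zero diagonal entries having zero rows, creates none.\<close>
proof (induction "card {k \<in> {..<n}. a k k \<noteq> 0}" arbitrary: a rule: less_induct)
  case less
  note a = less.prems
  show ?case
  proof (cases "\<exists>k<n. a k k \<noteq> 0")
    case False
    thus ?thesis using psd_form_zero_diag[OF a] by simp
  next
    case True
    then obtain k where k: "k < n" and nz: "a k k \<noteq> 0" by blast
    define a' where "a' i j = a i j - a i k * a k j / a k k" for i j
    have a': "psd_form n a'"
      using psd_form_schur_complement[OF a k nz] by (simp add: a'_def[abs_def])
    have "a' j j = 0" if "j < n" "a j j = 0" for j
      using psd_form_zero_diag[OF a that(1) k that(2)] that(2) by (simp add: a'_def)
    moreover have "a' k k = 0" using nz by (simp add: a'_def)
    ultimately have "{j \<in> {..<n}. a' j j \<noteq> 0} \<subset> {j \<in> {..<n}. a j j \<noteq> 0}"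
      using k nz by auto
    hence IH: "0 \<le> (\<Sum>i<n. \<Sum>j<n. a' i j * b j i)"
      by (intro less.hyps a' psubset_card_mono) auto
    \<comment> \<open>Row \<open>k\<close> of \<open>a\<close> is the conjugate of column
      \<open>k\<close>, so the rank-one part contributes the value of the form \<open>b\<close> at
      that column.\<close>
    have "(\<Sum>i<n. \<Sum>j<n. a i k * a k j * b j i) = (\<Sum>j<n. \<Sum>i<n. a i k * a k j * b j i)"
      by (rule sum.swap)
    also have "\<dots> = hform n b (\<lambda>i. a i k)"
      using psd_form_hermitian[OF a _ k] by (simp add: hform_def mult_ac)
    finally have *: "(\<Sum>i<n. \<Sum>j<n. a i k * a k j * b j i) = hform n b (\<lambda>i. a i k)" .
    have "(\<Sum>i<n. \<Sum>j<n. a i j * b j i) =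
      (\<Sum>i<n. \<Sum>j<n. a' i j * b j i) + (\<Sum>i<n. \<Sum>j<n. a i k * a k j * b j i) / a k k"
      by (simp add: a'_def sum_divide_distrib algebra_simps flip: sum.distrib)
    moreover have "0 \<le> hform n b (\<lambda>i. a i k) / a k k"
      using assms(2) psd_form_diag_nonneg[OF a k] unfolding psd_form_def
      by (metis complex_divide_nonneg)
    ultimately show ?thesis using IH by (simp add: *)
  qed
qed

text \<open>Exchanging the arguments of \<open>p\<close> transposes the form, which conjugating the
  vector compensates. This treats a transposition and a permutation of the basis at once.\<close>

lemma hform_reindex:
  assumes "bij_betw \<sigma> {..<n} {..<n}"
  shows "hform n (\<lambda>r s. p (\<sigma> s) (\<sigma> r)) (\<lambda>r. cnj (v (\<sigma> r))) = hform n p v"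
proof -
  have reindex: "(\<Sum>i<n. h i) = (\<Sum>r<n. h (\<sigma> r))" for h :: "nat \<Rightarrow> complex"
    by (rule sum.reindex_bij_betw[OF assms, symmetric])
  have "hform n p v = (\<Sum>i<n. \<Sum>r<n. p i (\<sigma> r) * v (\<sigma> r) * cnj (v i))"
    unfolding hform_def by (intro sum.cong refl reindex)
  also have "\<dots> = (\<Sum>s<n. \<Sum>r<n. p (\<sigma> s) (\<sigma> r) * v (\<sigma> r) * cnj (v (\<sigma> s)))"
    by (rule reindex)
  also have "\<dots> = (\<Sum>r<n. \<Sum>s<n. p (\<sigma> s) (\<sigma> r) * v (\<sigma> r) * cnj (v (\<sigma> s)))"
    by (rule sum.swap)
  finally show ?thesis by (simp add: hform_def mult_ac)
qed

lemma psd_form_reindex: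
  assumes \<sigma>: "bij_betw \<sigma> {..<n} {..<n}" and p: "psd_form n p"
  shows "psd_form n (\<lambda>r s. p (\<sigma> s) (\<sigma> r))"
  unfolding psd_form_def
proof
  fix w
  \<comment> \<open>The solution of \<open>cnj (v (\<sigma> r)) = w r\<close> for
    \<open>r < n\<close>.\<close>
  define v where "v k = cnj (w (the_inv_into {..<n} \<sigma> k))" for k
  have "hform n (\<lambda>r s. p (\<sigma> s) (\<sigma> r)) w = hform n (\<lambda>r s. p (\<sigma> s) (\<sigma> r)) (\<lambda>r. cnj (v (\<sigma> r)))"
    using \<sigma> by (intro hform_cong) (simp_all add: v_def bij_betw_def the_inv_into_f_f)
  also have "\<dots> = hform n p v" by (rule hform_reindex[OF \<sigma>])
  finally show "0 \<le> hform n (\<lambda>r s. p (\<sigma> s) (\<sigma> r)) w" using p by (simp add: psd_form_def)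
qed

section \<open>Rank-one projections and their complements\<close>

lemma mult_cnj_nonneg: "0 \<le> z * cnj z"
  by (simp add: less_eq_complex_def)

lemma psd_form_rank_one: "psd_form n (\<lambda>i j. u i * cnj (u j))"
  unfolding psd_form_def
proof
  fix v
  define z where "z = (\<Sum>i<n. u i * cnj (v i))"
  have "hform n (\<lambda>i j. u i * cnj (u j)) v = z * cnj z"
    unfolding hform_def z_def cnj_sum sum_product by (intro sum.cong refl) simp
  thus "0 \<le> hform n (\<lambda>i j. u i * cnj (u j)) v" by (simp only: mult_cnj_nonneg)
qed

text \<open>For a unit vector \<open>u\<close> the form at \<open>v\<close> is the squared norm of
  \<open>v - c u\<close>, where \<open>c u\<close> is the orthogonal projection of \<open>v\<close>
  onto \<open>u\<close>.\<close>

lemma psd_form_complement_rank_one: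
  assumes "(\<Sum>i<n. u i * cnj (u i)) = 1"
  shows "psd_form n (\<lambda>i j. (if i = j then 1 else 0) - u i * cnj (u j))"
  unfolding psd_form_def
proof
  fix v
  define c where "c = (\<Sum>i<n. v i * cnj (u i))"
  have cc: "cnj c = (\<Sum>i<n. u i * cnj (v i))" by (simp add: c_def mult_ac)
  have "hform n (\<lambda>i j. (if i = j then 1 else 0) - u i * cnj (u j)) v =
      (\<Sum>i<n. \<Sum>j<n. if i = j then v j * cnj (v i) else 0) - (\<Sum>i<n. \<Sum>j<n. u i * cnj (u j) * v j * cnj (v i))"
    unfolding hform_def sum_subtractf[symmetric]
    by (intro sum.cong refl) (simp add: left_diff_distrib)
  also have "\<dots> = (\<Sum>i<n. v i * cnj (v i)) - cnj c * c"
    unfolding cc unfolding c_def by (simp add: sum_product mult_ac)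
  \<comment> \<open>The two added terms cancel because \<open>u\<close> is a unit vector; they
    complete the square.\<close>
  also have "\<dots> = (\<Sum>i<n. v i * cnj (v i)) - c * cnj c - cnj c * c + c * cnj c * (\<Sum>i<n. u i * cnj (u i))"
    using assms by simp
  also have "\<dots> = (\<Sum>i<n. v i * cnj (v i)) - c * (\<Sum>i<n. u i * cnj (v i)) - cnj c * (\<Sum>i<n. v i * cnj (u i))
      + c * cnj c * (\<Sum>i<n. u i * cnj (u i))"
    unfolding cc[symmetric] unfolding c_def[symmetric] by simp
  also have "\<dots> = (\<Sum>i<n. (v i - c * u i) * cnj (v i - c * u i))"
    unfolding sum_distrib_left sum_subtractf[symmetric] sum.distrib[symmetric]
    by (intro sum.cong refl) (simp add: algebra_simps)
  also have "0 \<le> \<dots>" by (intro sum_nonneg mult_cnj_nonneg)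
  finally show "0 \<le> hform n (\<lambda>i j. (if i = j then 1 else 0) - u i * cnj (u j)) v" .
qed

section \<open>Spanning families of states\<close>

lemma rank_one_density_operator:
  assumes "(\<Sum>i<n. u i * cnj (u i)) = 1"
  shows "density_operator n (mat n n (\<lambda>(i, j). u i * cnj (u j)))"
  using assms psd_form_rank_one[of n u]
  by (simp add: density_operator_def psd_iff_psd_form mat_trace_def cong: psd_form_cong)

text \<open>Polarization writes the matrix unit at \<open>(k, l)\<close> as a combination of these four states.\<close>

definition pol_vec :: "nat \<Rightarrow> nat \<Rightarrow> nat \<Rightarrow> nat \<Rightarrow> complex" where
  "pol_vec k l s i = (if k = l then of_bool (i = k)
     else (of_bool (i = k) + \<i> ^ s * of_bool (i = l)) / of_real (sqrt 2))"

definition pol_state :: "nat \<Rightarrow> nat \<Rightarrow> nat \<Rightarrow> nat \<Rightarrow> complex mat" where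
  "pol_state n k l s = mat n n (\<lambda>(i, j). pol_vec k l s i * cnj (pol_vec k l s j))"

text \<open>For \<open>k = l\<close> the four states coincide, hence equal weights.\<close>

definition pol_coeff :: "nat \<Rightarrow> nat \<Rightarrow> nat \<Rightarrow> complex" where
  "pol_coeff k l s = (if k = l then 1 / 4 else \<i> ^ s / 2)"

lemma pol_vec_mult:
  assumes "k \<noteq> l"
  shows "pol_vec k l s i * cnj (pol_vec k l s j) =
    (of_bool (i = k) + \<i> ^ s * of_bool (i = l)) * (of_bool (j = k) + (- \<i>) ^ s * of_bool (j = l)) / 2"
proof -
  have "complex_of_real (sqrt 2) * complex_of_real (sqrt 2) = 2"
    by (simp flip: of_real_mult)
  thus ?thesis using assms by (simp add: pol_vec_def)
qed

text \<open>For \<open>k \<noteq> l\<close> only the term with \<open>i = k\<close> and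
  \<open>j = l\<close> has a phase independent of \<open>s\<close>; the phases of the other three
  terms sum to zero.\<close>

lemma sum_pol_coeff:
  "(\<Sum>s<4. pol_coeff k l s * (pol_vec k l s i * cnj (pol_vec k l s j))) = of_bool (i = k \<and> j = l)"
proof (cases "k = l")
  case True
  thus ?thesis by (simp add: pol_coeff_def pol_vec_def)
next
  case False
  have 4: "{..<4::nat} = {0, 1, 2, 3}" by auto
  show ?thesis
    using False by (simp add: pol_vec_mult pol_coeff_def 4 power3_eq_cube power2_eq_square)
qed

lemma pol_state_density_operator:
  assumes "k < n" "l < n"
  shows "density_operator n (pol_state n k l s)"
  unfolding pol_state_def
proof (rule rank_one_density_operator, cases "k = l")
  case True
  hence "pol_vec k l s i * cnj (pol_vec k l s i) = (if i = k then 1 else 0)" for i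
    by (simp add: pol_vec_def)
  thus "(\<Sum>i<n. pol_vec k l s i * cnj (pol_vec k l s i)) = 1"
    using assms by simp
next
  case False
  have "\<i> ^ s * (- \<i>) ^ s = 1" by (simp flip: power_mult_distrib)
  hence "pol_vec k l s i * cnj (pol_vec k l s i) = (if i = k then 1 / 2 else 0) + (if i = l then 1 / 2 else 0)" for i
    using False by (simp add: pol_vec_mult)
  thus "(\<Sum>i<n. pol_vec k l s i * cnj (pol_vec k l s i)) = 1"
    using assms by (simp add: sum.distrib)
qed

text \<open>These are the projections onto \<open>e_0\<close> and
  \<open>(e_0 + e_1) / sqrt 2\<close>, whose overlap is \<open>1 / 2\<close>.\<close>

lemma pol_states_not_orthogonal:
  assumes "2 \<le> n"
  shows "pol_state n 0 0 0 \<noteq> pol_state n 0 1 0" "mat_trace (pol_state n 0 0 0 * pol_state n 0 1 0) \<noteq> 0"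
proof -
  have 0: "pol_state n 0 0 0 $$ (i, j) = of_bool (i = 0 \<and> j = 0)"
    and 1: "pol_state n 0 1 0 $$ (i, j) = (of_bool (i \<le> 1) * of_bool (j \<le> 1)) / 2"
    if "i < n" "j < n" for i j
    using that pol_vec_mult[of 0 1 0 i j]
    by (auto simp: pol_state_def pol_vec_def le_Suc_eq)
  show "pol_state n 0 0 0 \<noteq> pol_state n 0 1 0"
    using 0[of 1 1] 1[of 1 1] assms by auto
  have "mat_trace (pol_state n 0 0 0 * pol_state n 0 1 0) =
      (\<Sum>i<n. \<Sum>j<n. pol_state n 0 0 0 $$ (i, j) * pol_state n 0 1 0 $$ (j, i))"
    by (simp add: mat_trace_def pol_state_def scalar_prod_def atLeast0LessThan)
  also have "\<dots> = (\<Sum>i<n. \<Sum>j<n. if i = 0 then if j = 0 then 1 / 2 else 0 else 0)"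
    by (intro sum.cong refl) (simp add: 0 1[simplified])
  also have "\<dots> = (\<Sum>i<n. if i = 0 then \<Sum>j<n. if j = 0 then 1 / 2 else 0 else 0)"
    by (intro sum.cong) auto
  also have "\<dots> = 1 / 2" using assms by simp
  finally show "mat_trace (pol_state n 0 0 0 * pol_state n 0 1 0) \<noteq> 0"
    by (simp only: divide_eq_0_iff) simp
qed

text \<open>Spanning is over the complex numbers; real coefficients are later recovered from
  Hermiticity.\<close>

definition spans_matrices :: "nat \<Rightarrow> nat \<Rightarrow> (nat \<Rightarrow> complex mat) \<Rightarrow> bool" where
  "spans_matrices n N \<psi> \<longleftrightarrow> (\<forall>A. \<exists>c. \<forall>i<n. \<forall>j<n. A i j = (\<Sum>x<N. c x * \<psi> x $$ (i, j)))"

text \<open>Choice gives the coefficients as functions of a parameter \<open>z\<close>, so that a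
  whole family of matrices can be expanded at once.\<close>

lemma spans_matricesE:
  assumes "spans_matrices n N \<psi>"
  obtains c where "\<And>z i j. i < n \<Longrightarrow> j < n \<Longrightarrow> A z i j = (\<Sum>x<N. c z x * \<psi> x $$ (i, j))"
proof -
  have "\<forall>z. \<exists>c. \<forall>i<n. \<forall>j<n. A z i j = (\<Sum>x<N. c x * \<psi> x $$ (i, j))"
    using assms by (simp add: spans_matrices_def)
  from choice[OF this] show thesis using that by blast
qed

text \<open>The polarization states for all \<open>k\<close>, \<open>l\<close> and \<open>s\<close>
  are enumerated. In dimension one there is a single state, hence no pair as required by
  \<open>not_all_orthogonal\<close>.\<close>

lemma spanning_states_exist:
  assumes "2 \<le> n"
  obtains N \<psi> where "\<And>x. x < N \<Longrightarrow> density_operator n (\<psi> x)"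
    "not_all_orthogonal (\<psi> ` {..<N})" "spans_matrices n N \<psi>"
proof -
  define F where "F = {..<n} \<times> {..<n} \<times> {..<4::nat}"
  define P where "P = (\<lambda>(k, l, s). pol_state n k l s)"
  obtain f where f: "bij_betw f {..<card F} F"
    using ex_bij_betw_nat_finite[of F] by (auto simp: F_def atLeast0LessThan)
  show thesis
  proof (rule that)
    show "density_operator n ((P \<circ> f) x)" if "x < card F" for x
    proof -
      have "f x \<in> F" using f that by (auto simp: bij_betw_def)
      thus ?thesis using pol_state_density_operator by (auto simp: P_def F_def)
    qed
    have "(P \<circ> f) ` {..<card F} = P ` F"
      using f by (simp add: bij_betw_def flip: image_image image_comp)
    moreover have "pol_state n 0 0 0 \<in> P ` F" "pol_state n 0 1 0 \<in> P ` F"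
      using assms by (force simp: P_def F_def)+
    ultimately show "not_all_orthogonal ((P \<circ> f) ` {..<card F})"
      unfolding not_all_orthogonal_def using pol_states_not_orthogonal[OF assms] by metis
    show "spans_matrices n (card F) (P \<circ> f)"
      unfolding spans_matrices_def
    proof
      fix A :: "nat \<Rightarrow> nat \<Rightarrow> complex"
      define c where "c = (\<lambda>(k, l, s). A k l * pol_coeff k l s)"
      have "A i j = (\<Sum>x<card F. c (f x) * P (f x) $$ (i, j))" if "i < n" "j < n" for i j
      proof -
        have "(\<Sum>x<card F. c (f x) * P (f x) $$ (i, j)) = (\<Sum>z\<in>F. c z * P z $$ (i, j))"
          by (rule sum.reindex_bij_betw[OF f])
        also have "\<dots> = (\<Sum>k<n. \<Sum>l<n. \<Sum>s<4. c (k, l, s) * P (k, l, s) $$ (i, j))"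
          by (simp add: F_def sum.cartesian_product)
        also have "\<dots> = (\<Sum>k<n. \<Sum>l<n. A k l * of_bool (i = k \<and> j = l))"
          using that
          by (simp add: sum_pol_coeff[symmetric] sum_distrib_left c_def P_def pol_state_def mult.assoc)
        also have "\<dots> = (\<Sum>k<n. if k = i then \<Sum>l<n. if l = j then A k l else 0 else 0)"
          by (intro sum.cong refl) (auto simp: of_bool_def if_distrib cong: if_cong)
        also have "\<dots> = A i j" using that by simp
        finally show ?thesis by simp
      qed
      thus "\<exists>c. \<forall>i<n. \<forall>j<n. A i j = (\<Sum>x<card F. c x * (P \<circ> f) x $$ (i, j))"
        by (intro exI[of _ "c \<circ> f"]) simp
    qed
  qed
qed

section \<open>The witness game\<close>

lemma linear_map_sum:
  assumes S: "linear_map d S" and "finite F" and \<psi>: "\<And>x. x \<in> F \<Longrightarrow> \<psi> x \<in> carrier_mat d d"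
    and A: "A \<in> carrier_mat d d"
    and eq: "\<And>i j. i < d \<Longrightarrow> j < d \<Longrightarrow> A $$ (i, j) = (\<Sum>x\<in>F. c x * \<psi> x $$ (i, j))"
    and ij: "i < d" "j < d"
  shows "S A $$ (i, j) = (\<Sum>x\<in>F. c x * S (\<psi> x) $$ (i, j))"
  using \<open>finite F\<close> \<psi> A eq
proof (induction F arbitrary: A)
  case empty
  \<comment> \<open>The empty sum needs \<open>S\<close> to map zero to zero, which homogeneity
    gives once \<open>A\<close> is written as zero times itself.\<close>
  hence "A = 0 \<cdot>\<^sub>m A" by (intro eq_matI) auto
  moreover have "S (0 \<cdot>\<^sub>m A) = 0 \<cdot>\<^sub>m S A" "S A \<in> carrier_mat d d"
    using S empty unfolding linear_map_def by blast+
  ultimately have "S A $$ (i, j) = (0 \<cdot>\<^sub>m S A) $$ (i, j)" by simp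
  thus ?case using ij \<open>S A \<in> carrier_mat d d\<close> by simp
next
  case (insert x F)
  define B where "B = mat d d (\<lambda>(i, j). \<Sum>x\<in>F. c x * \<psi> x $$ (i, j))"
  have B: "B \<in> carrier_mat d d" and \<psi>x: "\<psi> x \<in> carrier_mat d d"
    using insert.prems by (simp_all add: B_def)
  have SB: "S B \<in> carrier_mat d d" and S\<psi>: "S (\<psi> x) \<in> carrier_mat d d"
    using S B \<psi>x by (auto simp: linear_map_def)
  have "A = c x \<cdot>\<^sub>m \<psi> x + B"
    using insert.hyps insert.prems \<psi>x by (intro eq_matI) (auto simp: B_def carrier_matD[OF \<psi>x])
  hence "S A = c x \<cdot>\<^sub>m S (\<psi> x) + S B"
    using S B \<psi>x by (simp add: linear_map_def)
  moreover have "S B $$ (i, j) = (\<Sum>x\<in>F. c x * S (\<psi> x) $$ (i, j))"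
    using insert.prems B by (intro insert.IH) (simp_all add: B_def)
  ultimately show ?case using insert.hyps ij SB S\<psi> by simp
qed

text \<open>Takes the index of \<open>e_i \<otimes> e_a\<close>, with Alice's factor of dimension
  \<open>d\<close> first, to that of \<open>e_a \<otimes> e_i\<close>, with the ancilla of dimension
  \<open>m\<close> first.\<close>

definition swap_index :: "nat \<Rightarrow> nat \<Rightarrow> nat \<Rightarrow> nat" where
  "swap_index d m r = (r mod m) * d + r div m"

section \<open>Index arithmetic for the two orders of the tensor factors\<close>

lemma tensor_index_less:
  fixes i m :: nat
  assumes "i < m" "j < n"
  shows "i * n + j < m * n"
proof -
  have "i * n + j < Suc i * n" using assms by simp
  also have "\<dots> \<le> m * n" using assms by (intro mult_le_mono1) simp
  finally show ?thesis .
qed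

lemma tensor_index_div_mod:
  fixes r d m :: nat
  assumes "r < d * m"
  shows "r div m < d" "r mod m < m"
  using assms by (cases "m = 0"; simp add: less_mult_imp_div_less)+

lemma swap_index_less: "r < d * m \<Longrightarrow> swap_index d m r < d * m"
  using tensor_index_less[of "r mod m" m "r div m" d] tensor_index_div_mod[of r d m]
  by (simp add: swap_index_def mult.commute)

lemma swap_index_div_mod:
  assumes "r < d * m"
  shows "swap_index d m r div d = r mod m" "swap_index d m r mod d = r div m"
  using tensor_index_div_mod[OF assms] by (simp_all add: swap_index_def)

text \<open>The inverse is the same map with the two dimensions exchanged.\<close>

lemma bij_betw_swap_index: "bij_betw (swap_index d m) {..<d * m} {..<d * m}"
proof (rule bij_betw_byWitness[where f' = "swap_index m d"])
  show "\<forall>r \<in> {..<d * m}. swap_index m d (swap_index d m r) = r"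
    by (simp add: swap_index_def[of m d] swap_index_div_mod)
  show "\<forall>r \<in> {..<d * m}. swap_index d m (swap_index m d r) = r"
    using swap_index_div_mod[of _ m d] by (simp add: swap_index_def[of d m] mult.commute)
  show "swap_index d m ` {..<d * m} \<subseteq> {..<d * m}"
    using swap_index_less by auto
  show "swap_index m d ` {..<d * m} \<subseteq> {..<d * m}"
    using swap_index_less[of _ m d] by (auto simp: mult.commute)
qed

text \<open>
  The operator \<open>(S \<otimes> id) (\<rho>')\<close>, where \<open>\<rho>'\<close> is the partial transpose of \<open>\<rho>\<close> on the ancilla, with the
  two tensor factors swapped so that Alice's system comes first as in \<^const>\<open>bob_measurement\<close>.
\<close>

definition transposed_output ::
  "nat \<Rightarrow> nat \<Rightarrow> (complex mat \<Rightarrow> complex mat) \<Rightarrow> complex mat \<Rightarrow> nat \<Rightarrow> nat \<Rightarrow> complex" where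
  "transposed_output d m S \<rho> r s = S (block d \<rho> (s mod m) (r mod m)) $$ (r div m, s div m)"

text \<open>Transposing the ancilla amounts to transposing everything after transposing Alice's
  factor, hence the exchange of \<open>r\<close> and \<open>s\<close> on the right.\<close>

lemma transposed_output_eq:
  assumes "r < d * m" "s < d * m"
  shows "transposed_output d m S \<rho> r s =
    partial_transpose m d (id_tensor m d S \<rho>) $$ (swap_index d m s, swap_index d m r)"
proof -
  note qr = tensor_index_div_mod[OF assms(1)] tensor_index_div_mod[OF assms(2)]
  have "(s mod m) * d + r div m < m * d" "(r mod m) * d + s div m < m * d"
    using qr tensor_index_less by blast+
  thus ?thesis
    using assms qr swap_index_less[of r d m] swap_index_less[of s d m]
    by (simp add: transposed_output_def partial_transpose_def id_tensor_def swap_index_div_mod mult.commute[of m d])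
qed

text \<open>Only \<open>\<rho>\<close> is expanded, and \<open>S\<close> enters afterwards by
  linearity. So \<open>\<gamma>\<close> does not depend on \<open>S\<close>, and one game serves all
  channels.\<close>

lemma transposed_output_eq_sum_states:
  assumes \<rho>: "psd (m * d) \<rho>"
    and \<psi>: "\<And>x. x < N\<^sub>x \<Longrightarrow> density_operator d (\<psi> x)" "spans_matrices d N\<^sub>x \<psi>"
    and \<phi>: "\<And>y. y < N\<^sub>y \<Longrightarrow> density_operator m (\<phi> y)" "spans_matrices m N\<^sub>y \<phi>"
  obtains \<gamma> :: "nat \<Rightarrow> nat \<Rightarrow> real" where
    "\<And>S r s. linear_map d S \<Longrightarrow> r < d * m \<Longrightarrow> s < d * m \<Longrightarrow>
      transposed_output d m S \<rho> r s = (\<Sum>x<N\<^sub>x. \<Sum>y<N\<^sub>y. \<gamma> x y * kron (S (\<psi> x)) (\<phi> y) $$ (r, s))"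
proof -
  have herm: "cnj (\<psi> x $$ (i, j)) = \<psi> x $$ (j, i)" if "x < N\<^sub>x" "i < d" "j < d" for x i j
    using psd_form_hermitian[of d "\<lambda>i j. \<psi> x $$ (i, j)"] \<psi>(1) that
    by (simp add: density_operator_def psd_iff_psd_form)
  have herm': "cnj (\<phi> y $$ (a, b)) = \<phi> y $$ (b, a)" if "y < N\<^sub>y" "a < m" "b < m" for y a b
    using psd_form_hermitian[of m "\<lambda>i j. \<phi> y $$ (i, j)"] \<phi>(1) that
    by (simp add: density_operator_def psd_iff_psd_form)
  have \<psi>C: "\<psi> x \<in> carrier_mat d d" if "x < N\<^sub>x" for x
    using \<psi>(1)[OF that] by (simp add: density_operator_def psd_def)
  have \<phi>C: "\<phi> y \<in> carrier_mat m m" if "y < N\<^sub>y" for y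
    using \<phi>(1)[OF that] by (simp add: density_operator_def psd_def)
  \<comment> \<open>The pair \<open>(a, b)\<close> stands for the block in row \<open>b\<close> and
    column \<open>a\<close>: this is the partial transpose on the ancilla.\<close>
  obtain c where c: "\<And>ab i j. i < d \<Longrightarrow> j < d \<Longrightarrow>
      \<rho> $$ (snd ab * d + i, fst ab * d + j) = (\<Sum>x<N\<^sub>x. c ab x * \<psi> x $$ (i, j))"
    by (rule spans_matricesE[OF \<psi>(2), where A = "\<lambda>ab i j. \<rho> $$ (snd ab * d + i, fst ab * d + j)"]) (rule that, simp)
  \<comment> \<open>For fixed \<open>x\<close> the coefficients form a matrix on the ancilla, which
    is expanded in turn.\<close>
  obtain e where e: "\<And>x a b. a < m \<Longrightarrow> b < m \<Longrightarrow> c (a, b) x = (\<Sum>y<N\<^sub>y. e x y * \<phi> y $$ (a, b))"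
    by (rule spans_matricesE[OF \<phi>(2), where A = "\<lambda>x a b. c (a, b) x"]) (rule that, simp)
  have \<rho>e: "\<rho> $$ (b * d + i, a * d + j) = (\<Sum>x<N\<^sub>x. \<Sum>y<N\<^sub>y. e x y * (\<psi> x $$ (i, j) * \<phi> y $$ (a, b)))"
    if "i < d" "j < d" "a < m" "b < m" for i j a b
    using that c[of i j "(a, b)"] by (simp add: e sum_distrib_right sum_distrib_left mult_ac)
  \<comment> \<open>As all operators are Hermitian, the coefficients may be replaced by their real parts.\<close>
  have \<rho>e': "\<rho> $$ (b * d + i, a * d + j) = (\<Sum>x<N\<^sub>x. \<Sum>y<N\<^sub>y. cnj (e x y) * (\<psi> x $$ (i, j) * \<phi> y $$ (a, b)))"
    if "i < d" "j < d" "a < m" "b < m" for i j a b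
  proof -
    have "\<rho> $$ (b * d + i, a * d + j) = cnj (\<rho> $$ (a * d + j, b * d + i))"
      using psd_form_hermitian[of "m * d" "\<lambda>i j. \<rho> $$ (i, j)"] \<rho> that tensor_index_less
      by (simp add: psd_iff_psd_form)
    also have "\<dots> = (\<Sum>x<N\<^sub>x. \<Sum>y<N\<^sub>y. cnj (e x y) * (\<psi> x $$ (i, j) * \<phi> y $$ (a, b)))"
      using that by (simp add: \<rho>e herm herm')
    finally show ?thesis .
  qed
  define \<gamma> where "\<gamma> x y = Re (e x y)" for x y
  have \<rho>\<gamma>: "\<rho> $$ (b * d + i, a * d + j) = (\<Sum>x<N\<^sub>x. (\<Sum>y<N\<^sub>y. \<gamma> x y * \<phi> y $$ (a, b)) * \<psi> x $$ (i, j))"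
    if "i < d" "j < d" "a < m" "b < m" for i j a b
  proof -
    let ?s = "\<Sum>x<N\<^sub>x. \<Sum>y<N\<^sub>y. \<gamma> x y * (\<psi> x $$ (i, j) * \<phi> y $$ (a, b))"
    have "2 * \<rho> $$ (b * d + i, a * d + j) =
        (\<Sum>x<N\<^sub>x. \<Sum>y<N\<^sub>y. (e x y + cnj (e x y)) * (\<psi> x $$ (i, j) * \<phi> y $$ (a, b)))"
      using \<rho>e[OF that] \<rho>e'[OF that] by (simp add: distrib_right sum.distrib)
    also have "\<dots> = 2 * ?s"
      by (simp add: complex_add_cnj \<gamma>_def sum_distrib_left mult.assoc)
    finally have "\<rho> $$ (b * d + i, a * d + j) = ?s" by simp
    thus ?thesis by (simp add: sum_distrib_right sum_distrib_left mult_ac)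
  qed
  show thesis
  proof (rule that)
    fix S r s
    assume S: "linear_map d S" and rs: "r < d * m" "s < d * m"
    note qr = tensor_index_div_mod[OF rs(1)] tensor_index_div_mod[OF rs(2)]
    have "transposed_output d m S \<rho> r s =
        (\<Sum>x<N\<^sub>x. (\<Sum>y<N\<^sub>y. \<gamma> x y * \<phi> y $$ (r mod m, s mod m)) * S (\<psi> x) $$ (r div m, s div m))"
      unfolding transposed_output_def
      using qr \<psi>C by (intro linear_map_sum[OF S]) (auto simp: block_def \<rho>\<gamma>)
    also have "\<dots> = (\<Sum>x<N\<^sub>x. \<Sum>y<N\<^sub>y. \<gamma> x y * kron (S (\<psi> x)) (\<phi> y) $$ (r, s))"
      unfolding sum_distrib_right
    proof (intro sum.cong refl)
      fix x y assume "x \<in> {..<N\<^sub>x}" "y \<in> {..<N\<^sub>y}"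
      hence "S (\<psi> x) \<in> carrier_mat d d" "\<phi> y \<in> carrier_mat m m"
        using S \<psi>C \<phi>C by (auto simp: linear_map_def)
      thus "\<gamma> x y * \<phi> y $$ (r mod m, s mod m) * S (\<psi> x) $$ (r div m, s div m) =
          \<gamma> x y * kron (S (\<psi> x)) (\<phi> y) $$ (r, s)"
        using rs by (simp add: kron_def)
    qed
    finally show "transposed_output d m S \<rho> r s =
        (\<Sum>x<N\<^sub>x. \<Sum>y<N\<^sub>y. \<gamma> x y * kron (S (\<psi> x)) (\<phi> y) $$ (r, s))" .
  qed
qed

section \<open>The average payoff as a trace\<close>

lemma mat_trace_mult:
  assumes "A \<in> carrier_mat n n" "B \<in> carrier_mat n n"
  shows "mat_trace (A * B) = (\<Sum>i<n. \<Sum>j<n. A $$ (i, j) * B $$ (j, i))"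
  using assms by (simp add: mat_trace_def scalar_prod_def atLeast0LessThan)

text \<open>
  The factor \<open>N\<^sub>x * N\<^sub>y\<close> in the payoff cancels the uniform probabilities.
\<close>

definition witness_game ::
  "nat \<Rightarrow> nat \<Rightarrow> nat \<Rightarrow> (nat \<Rightarrow> complex mat) \<Rightarrow> (nat \<Rightarrow> complex mat) \<Rightarrow> (nat \<Rightarrow> nat \<Rightarrow> real) \<Rightarrow> signaling_game" where
  "witness_game m N\<^sub>x N\<^sub>y \<psi> \<phi> \<gamma> = \<lparr>dim_B = m, num_x = N\<^sub>x, num_y = N\<^sub>y, num_b = 2,
     state_A = \<psi>, state_B = \<phi>, prob_A = (\<lambda>_. 1 / N\<^sub>x), prob_B = (\<lambda>_. 1 / N\<^sub>y),
     payoff = (\<lambda>b x y. if b = 0 then \<gamma> x y * N\<^sub>x * N\<^sub>y else 0)\<rparr>"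

text \<open>Only outcome \<open>0\<close> pays, and the trace against \<open>M 0\<close> is linear,
  so summing over the questions first rebuilds \<open>T\<close>.\<close>

lemma average_payoff_witness_game:
  assumes S: "linear_map d S"
    and \<psi>: "\<And>x. x < N\<^sub>x \<Longrightarrow> density_operator d (\<psi> x)"
    and \<phi>: "\<And>y. y < N\<^sub>y \<Longrightarrow> density_operator m (\<phi> y)"
    and \<gamma>: "\<And>r s. r < d * m \<Longrightarrow> s < d * m \<Longrightarrow>
      T r s = (\<Sum>x<N\<^sub>x. \<Sum>y<N\<^sub>y. \<gamma> x y * kron (S (\<psi> x)) (\<phi> y) $$ (r, s))"
    and M: "M 0 \<in> carrier_mat (d * m) (d * m)"
  shows "average_payoff (witness_game m N\<^sub>x N\<^sub>y \<psi> \<phi> \<gamma>) S M =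
    Re (\<Sum>r<d * m. \<Sum>s<d * m. T r s * M 0 $$ (s, r))"
proof -
  let ?K = "\<lambda>x y. kron (S (\<psi> x)) (\<phi> y)"
  have K: "?K x y \<in> carrier_mat (d * m) (d * m)" if "x < N\<^sub>x" "y < N\<^sub>y" for x y
  proof -
    have "S (\<psi> x) \<in> carrier_mat d d" "\<phi> y \<in> carrier_mat m m"
      using S \<psi>[OF that(1)] \<phi>[OF that(2)] by (auto simp: linear_map_def density_operator_def psd_def)
    thus ?thesis by (auto simp: kron_def)
  qed
  have 2: "{..<2::nat} = {0, 1}" by auto
  have "average_payoff (witness_game m N\<^sub>x N\<^sub>y \<psi> \<phi> \<gamma>) S M =
      (\<Sum>x<N\<^sub>x. \<Sum>y<N\<^sub>y. \<gamma> x y * N\<^sub>x * N\<^sub>y * Re (mat_trace (?K x y * M 0)) * (1 / N\<^sub>x) * (1 / N\<^sub>y))"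
    unfolding average_payoff_def witness_game_def correlation_def by (simp add: 2)
  \<comment> \<open>Cancelling is sound because a summand exists only if both numbers of questions
    are positive.\<close>
  also have "\<dots> = (\<Sum>x<N\<^sub>x. \<Sum>y<N\<^sub>y. \<gamma> x y * Re (mat_trace (?K x y * M 0)))"
    by (intro sum.cong refl) auto
  also have "\<dots> = Re (\<Sum>x<N\<^sub>x. \<Sum>y<N\<^sub>y. \<gamma> x y * mat_trace (?K x y * M 0))"
    by simp
  also have "(\<Sum>x<N\<^sub>x. \<Sum>y<N\<^sub>y. \<gamma> x y * mat_trace (?K x y * M 0)) =
      (\<Sum>(x, y)\<in>{..<N\<^sub>x} \<times> {..<N\<^sub>y}. \<Sum>(r, s)\<in>{..<d * m} \<times> {..<d * m}. \<gamma> x y * ?K x y $$ (r, s) * M 0 $$ (s, r))"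
    unfolding sum.cartesian_product[symmetric]
    by (intro sum.cong refl) (simp add: mat_trace_mult[OF K M] sum_distrib_left mult.assoc)
  also have "\<dots> = (\<Sum>(r, s)\<in>{..<d * m} \<times> {..<d * m}. \<Sum>(x, y)\<in>{..<N\<^sub>x} \<times> {..<N\<^sub>y}. \<gamma> x y * ?K x y $$ (r, s) * M 0 $$ (s, r))"
    unfolding case_prod_beta by (rule sum.swap)
  also have "\<dots> = (\<Sum>r<d * m. \<Sum>s<d * m. T r s * M 0 $$ (s, r))"
    unfolding sum.cartesian_product[symmetric]
    by (intro sum.cong refl) (simp add: \<gamma> sum_distrib_right)
  finally show ?thesis .
qed

section \<open>Payoffs of channels\<close>

text \<open>For \<open>d = 1\<close> the partial transpose does nothing, and for
  \<open>m = 1\<close> it is the full transpose, which preserves positivity. Hence an NPT output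
  forces both dimensions to be at least two.\<close>

lemma PPT_trivial_dimension:
  assumes S: "quantum_channel d S" and \<rho>: "psd (m * d) \<rho>" and "1 \<le> m" and "m = 1 \<or> d = 1"
  shows "PPT m d (id_tensor m d S \<rho>)"
proof -
  let ?X = "id_tensor m d S \<rho>"
  have X: "psd (m * d) ?X"
    using S \<rho> \<open>1 \<le> m\<close> by (simp add: quantum_channel_def completely_positive_def)
  show ?thesis
  proof (cases "d = 1")
    case True
    have "partial_transpose m d ?X = ?X"
      using True by (intro eq_matI) (simp_all add: partial_transpose_def id_tensor_def)
    thus ?thesis using X by (simp add: PPT_def)
  next
    case False
    hence "m = 1" using assms(4) by simp
    \<comment> \<open>Reindexing along the identity is plain transposition.\<close>
    have "psd_form d (\<lambda>i j. ?X $$ (j, i))"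
      using psd_form_reindex[of id d "\<lambda>i j. ?X $$ (i, j)"] X \<open>m = 1\<close> by (simp add: psd_iff_psd_form)
    thus ?thesis
      using \<open>m = 1\<close> by (simp add: PPT_def psd_iff_psd_form partial_transpose_def cong: psd_form_cong)
  qed
qed

lemma transposed_output_psd:
  assumes "PPT m d (id_tensor m d S \<rho>)"
  shows "psd_form (d * m) (transposed_output d m S \<rho>)"
proof -
  have "psd_form (d * m) (\<lambda>i j. partial_transpose m d (id_tensor m d S \<rho>) $$ (i, j))"
    using assms by (simp add: PPT_def psd_iff_psd_form mult.commute)
  from psd_form_reindex[OF bij_betw_swap_index this] show ?thesis
    by (simp add: transposed_output_eq cong: psd_form_cong)
qed

text \<open>A vector violating positivity of the partial transpose is carried over by conjugation
  and the exchange of the factors.\<close>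

lemma transposed_output_negative:
  assumes X: "psd (m * d) (id_tensor m d S \<rho>)" and "\<not> PPT m d (id_tensor m d S \<rho>)"
  obtains w where "Im (hform (d * m) (transposed_output d m S \<rho>) w) = 0"
    "Re (hform (d * m) (transposed_output d m S \<rho>) w) < 0"
proof -
  let ?X = "id_tensor m d S \<rho>"
  define P where "P i j = partial_transpose m d ?X $$ (i, j)" for i j
  have "partial_transpose m d ?X \<in> carrier_mat (m * d) (m * d)"
    by (simp add: partial_transpose_def)
  then obtain v where v: "\<not> 0 \<le> hform (d * m) P v"
    using assms(2) by (auto simp: PPT_def psd_iff_psd_form psd_form_def P_def[abs_def] mult.commute)
  \<comment> \<open>In the order on \<open>complex\<close> a value that is not nonnegative could
    also be non-real; Hermiticity excludes this.\<close>
  have "cnj (P i j) = P j i" if "i < d * m" "j < d * m" for i j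
  proof -
    have ij: "i < m * d" "j < m * d" using that by (simp_all add: mult.commute)
    note tensor_index_div_mod[OF ij(1)] tensor_index_div_mod[OF ij(2)]
    hence "(i div d) * d + j mod d < m * d" "(j div d) * d + i mod d < m * d"
      using tensor_index_less by blast+
    thus ?thesis
      using psd_form_hermitian[of "m * d" "\<lambda>i j. ?X $$ (i, j)"] X ij
      by (simp add: P_def partial_transpose_def psd_iff_psd_form)
  qed
  hence im: "Im (hform (d * m) P v) = 0" by (rule hform_hermitian_real)
  have "hform (d * m) (transposed_output d m S \<rho>) (\<lambda>r. cnj (v (swap_index d m r))) =
      hform (d * m) (\<lambda>r s. P (swap_index d m s) (swap_index d m r)) (\<lambda>r. cnj (v (swap_index d m r)))"
    by (intro hform_cong) (simp_all add: transposed_output_eq P_def)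
  also have "\<dots> = hform (d * m) P v" by (rule hform_reindex[OF bij_betw_swap_index])
  finally have eq: "hform (d * m) (transposed_output d m S \<rho>) (\<lambda>r. cnj (v (swap_index d m r))) = hform (d * m) P v" .
  have "Re (hform (d * m) P v) < 0" using im v by (simp add: less_eq_complex_def not_le)
  thus thesis by (intro that[of "\<lambda>r. cnj (v (swap_index d m r))"]) (simp_all add: eq im)
qed

text \<open>Outcome \<open>0\<close> is the projection onto \<open>u\<close> and outcome
  \<open>1\<close> its complement.\<close>

lemma rank_one_measurement:
  assumes "(\<Sum>i<n. u i * cnj (u i)) = 1"
  obtains M where "povm n 2 M" "M 0 \<in> carrier_mat n n"
    "\<And>a. (\<Sum>r<n. \<Sum>s<n. a r s * M 0 $$ (s, r)) = hform n a u"
proof -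
  define M where "M b = mat n n (\<lambda>(i, j). if b = 0 then u i * cnj (u j)
    else (if i = j then 1 else 0) - u i * cnj (u j))" for b :: nat
  have 2: "{..<2::nat} = {0, 1}" by auto
  show thesis
  proof (rule that)
    have "psd n (M b)" for b
      using psd_form_rank_one[of n u] psd_form_complement_rank_one[OF assms]
      by (cases "b = 0") (simp_all add: psd_iff_psd_form M_def cong: psd_form_cong)
    moreover have "mat n n (\<lambda>ij. \<Sum>b<2. M b $$ ij) = 1\<^sub>m n"
      by (intro eq_matI) (auto simp: M_def 2)
    ultimately show "povm n 2 M" by (simp add: povm_def)
    show "M 0 \<in> carrier_mat n n" by (simp add: M_def)
    show "(\<Sum>r<n. \<Sum>s<n. a r s * M 0 $$ (s, r)) = hform n a u" for a
      by (simp add: hform_def M_def mult.assoc)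
  qed
qed

text \<open>The form vanishes at zero, so \<open>w\<close> is nonzero, and normalizing it only
  scales the value by a positive factor.\<close>

lemma hform_negative_normalize:
  assumes "Im (hform n a w) = 0" "Re (hform n a w) < 0"
  obtains u where "(\<Sum>i<n. u i * cnj (u i)) = 1" "Re (hform n a u) < 0"
proof -
  define W where "W = (\<Sum>i<n. (cmod (w i))\<^sup>2)"
  have "W \<noteq> 0"
  proof
    assume "W = 0"
    hence "\<forall>i<n. w i = 0" by (simp add: W_def sum_nonneg_eq_0_iff)
    hence "hform n a w = 0" by (simp add: hform_def)
    thus False using assms by simp
  qed
  moreover have "W \<ge> 0" by (simp add: W_def sum_nonneg)
  ultimately have W: "W > 0" by simp
  define u where "u i = w i / sqrt W" for i
  have sq: "complex_of_real (sqrt W) * complex_of_real (sqrt W) = W"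
    using W by (simp flip: of_real_mult)
  show thesis
  proof (rule that)
    have "(\<Sum>i<n. u i * cnj (u i)) = (\<Sum>i<n. w i * cnj (w i)) / W"
      by (simp add: u_def sq sum_divide_distrib)
    also have "(\<Sum>i<n. w i * cnj (w i)) = W" by (simp add: W_def complex_norm_square del: of_real_power)
    finally show "(\<Sum>i<n. u i * cnj (u i)) = 1" using W by simp
    have "hform n a u = hform n a w / W"
      by (simp add: hform_def u_def sq sum_divide_distrib mult.assoc)
    thus "Re (hform n a u) < 0" using assms W by (simp add: divide_neg_pos)
  qed
qed

section \<open>Construction of the game that detects a channel outside \<open>NPTBC\<close>\<close>

theorem theorem2:
  fixes d :: nat and R :: "complex mat \<Rightarrow> complex mat"
  assumes "d \<ge> 1"
    and "quantum_channel d R"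
    and "R \<notin> NPTBC d"
  shows "\<exists>G. semiquantum_signaling_game d G \<and>
    (\<exists>M. bob_measurement d G M \<and> average_payoff G R M < 0) \<and>
    (\<forall>S \<in> NPTBC d. \<forall>M. bob_measurement d G M \<longrightarrow> average_payoff G S M \<ge> 0)"
proof -
  obtain m \<rho> where m: "1 \<le> m" and \<rho>: "density_operator (m * d) \<rho>"
    and NPT: "\<not> PPT m d (id_tensor m d R \<rho>)"
    using assms(2,3) by (auto simp: NPTBC_def)
  have \<rho>': "psd (m * d) \<rho>" using \<rho> by (simp add: density_operator_def)
  \<comment> \<open>Both question spaces must be large enough to carry two distinct nonorthogonal
    states.\<close>
  have "2 \<le> d" "2 \<le> m"
    using PPT_trivial_dimension[OF assms(2) \<rho>' m] NPT \<open>d \<ge> 1\<close> m by force+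
  obtain N\<^sub>x \<psi> where \<psi>: "\<And>x. x < N\<^sub>x \<Longrightarrow> density_operator d (\<psi> x)"
      "not_all_orthogonal (\<psi> ` {..<N\<^sub>x})" "spans_matrices d N\<^sub>x \<psi>"
    using spanning_states_exist[OF \<open>2 \<le> d\<close>] by blast
  obtain N\<^sub>y \<phi> where \<phi>: "\<And>y. y < N\<^sub>y \<Longrightarrow> density_operator m (\<phi> y)"
      "not_all_orthogonal (\<phi> ` {..<N\<^sub>y})" "spans_matrices m N\<^sub>y \<phi>"
    using spanning_states_exist[OF \<open>2 \<le> m\<close>] by blast
  \<comment> \<open>A family with a nonorthogonal pair is nonempty, so the uniform weights sum to
    one.\<close>
  have N: "0 < N\<^sub>x" "0 < N\<^sub>y"
    using \<psi>(2) \<phi>(2) by (auto simp: not_all_orthogonal_def)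
  obtain \<gamma> :: "nat \<Rightarrow> nat \<Rightarrow> real" where \<gamma>: "\<And>S r s. linear_map d S \<Longrightarrow> r < d * m \<Longrightarrow> s < d * m \<Longrightarrow>
      transposed_output d m S \<rho> r s = (\<Sum>x<N\<^sub>x. \<Sum>y<N\<^sub>y. \<gamma> x y * kron (S (\<psi> x)) (\<phi> y) $$ (r, s))"
    using transposed_output_eq_sum_states[OF \<rho>' \<psi>(1,3) \<phi>(1,3)] by blast
  define G where "G = witness_game m N\<^sub>x N\<^sub>y \<psi> \<phi> \<gamma>"
  have payoff: "average_payoff G S M =
      Re (\<Sum>r<d * m. \<Sum>s<d * m. transposed_output d m S \<rho> r s * M 0 $$ (s, r))"
    if "linear_map d S" "M 0 \<in> carrier_mat (d * m) (d * m)" for S M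
    unfolding G_def using that \<psi>(1) \<phi>(1) \<gamma>
    by (intro average_payoff_witness_game) auto
  have measurement: "bob_measurement d G M \<longleftrightarrow> povm (d * m) 2 M" for M
    by (simp add: bob_measurement_def G_def witness_game_def)
  have "semiquantum_signaling_game d G"
    using \<psi>(1,2) \<phi>(1,2) N
    by (simp add: semiquantum_signaling_game_def G_def witness_game_def probability_distribution_def)
  moreover have "\<exists>M. bob_measurement d G M \<and> average_payoff G R M < 0"
  proof -
    have lin: "linear_map d R" and "psd (m * d) (id_tensor m d R \<rho>)"
      using assms(2) \<rho>' m by (simp_all add: quantum_channel_def completely_positive_def)
    then obtain w where "Im (hform (d * m) (transposed_output d m R \<rho>) w) = 0"
        "Re (hform (d * m) (transposed_output d m R \<rho>) w) < 0"
      using transposed_output_negative NPT by blast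
    then obtain u where u: "(\<Sum>i<d * m. u i * cnj (u i)) = 1"
        "Re (hform (d * m) (transposed_output d m R \<rho>) u) < 0"
      using hform_negative_normalize by blast
    \<comment> \<open>Projecting onto \<open>u\<close> makes the payoff the real part of the form at
      \<open>u\<close>.\<close>
    obtain M where "povm (d * m) 2 M" "M 0 \<in> carrier_mat (d * m) (d * m)"
      "\<And>a. (\<Sum>r<d * m. \<Sum>s<d * m. a r s * M 0 $$ (s, r)) = hform (d * m) a u"
      using rank_one_measurement[OF u(1)] by blast
    thus ?thesis using u(2) lin by (auto simp: measurement payoff)
  qed
  moreover have "average_payoff G S M \<ge> 0" if S: "S \<in> NPTBC d" and M: "bob_measurement d G M" for S M
  proof -
    have lin: "linear_map d S" and PPT: "PPT m d (id_tensor m d S \<rho>)"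
      using S m \<rho> by (auto simp: NPTBC_def quantum_channel_def)
    \<comment> \<open>The transposed output of \<open>S\<close> is positive as well, so the trace of
      its product with \<open>M 0\<close> is nonnegative.\<close>
    have "psd (d * m) (M 0)" using M by (simp add: measurement povm_def)
    hence "psd_form (d * m) (\<lambda>i j. M 0 $$ (i, j))" "M 0 \<in> carrier_mat (d * m) (d * m)"
      by (simp_all add: psd_iff_psd_form)
    thus ?thesis
      using psd_form_trace_mult_nonneg[OF transposed_output_psd[OF PPT]]
      by (simp add: payoff[OF lin] less_eq_complex_def)
  qed
  ultimately show ?thesis by blast
qed

end
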